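(* Consider the 2-person linear-quadratic dynamic game with open-loop information pattern, player 1 as leader and player 2 as follower: for $k\in K=\{1,\dots,T\}$, $$x_k=A_kx_{k-1}+B_k^1u_k^1+B_k^2u_k^2,\quad x_0\text{ given},\qquad L^i=\sum_{k=1}^T\tfrac12\big(x_k'Q_k^ix_k+u_k^{i'}u_k^i+u_k^{j'}R_k^{ij}u_k^j\big),\quad i,j\in\{1,2\},\ i\ne j.$$ Consider the coupled system, for $k\in\{0,\dots,T-1\}$, in which $X_{k+1}:=B_{k+1}^{2'}Q_{k+1}^2B_{k+1}^2+I$: $$\Phi_k=D_{k+1}^{-1}E_{k},\qquad E_k:=A_{k+1}-B_{k+1}^1B_{k+1}^{1'}Q_{k+1}^2(I+B_{k+1}^2B_{k+1}^{2'}Q_{k+1}^2)^{-1}A_{k+1}M_k,$$ $$D_{k+1}:=I+B_{k+1}^1B_{k+1}^{1'}(I+Q_{k+1}^2B_{k+1}^2B_{k+1}^{2'})^{-1}\Lambda_{k+1}+B_{k+1}^1B_{k+1}^{1'}Q_{k+1}^2B_{k+1}^2X_{k+1}^{-1}R_{k+1}^{12}B_{k+1}^{2'}P_{k+1}+B_{k+1}^2B_{k+1}^{2'}P_{k+1},$$ $$P_k=Q_k^2+A_{k+1}'P_{k+1}\Phi_k,\quad P_T=Q_T^2,$$ $$\Lambda_k=Q_k^1+A_{k+1}'\big(\Lambda_{k+1}\Phi_k+Q_{k+1}^2A_{k+1}M_k-Q_{k+1}^2B_{k+1}^2N_{k+1}\big),\quad \Lambda_T=Q_T^1,$$ $$M_{k+1}=(A_{k+1}M_k-B_{k+1}^2N_{k+1})\Phi_k^{-1},\quad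 M_0=0,$$ $$N_{k+1}=X_{k+1}^{-1}\big(B_{k+1}^{2'}\Lambda_{k+1}\Phi_k-R_{k+1}^{12}B_{k+1}^{2'}K_{k+1}^2+B_{k+1}^{2'}Q_{k+1}^2A_{k+1}M_k\big),$$ $$K_{k+1}^1=(I+Q_{k+1}^2B_{k+1}^2B_{k+1}^{2'})^{-1}\Lambda_{k+1}\Phi_k+Q_{k+1}^2B_{k+1}^2X_{k+1}^{-1}R_{k+1}^{12}B_{k+1}^{2'}P_{k+1}\Phi_k+Q_{k+1}^2(I+B_{k+1}^2B_{k+1}^{2'}Q_{k+1}^2)^{-1}A_{k+1}M_k,$$ $$K_{k+1}^2=P_{k+1}\Phi_k.$$ Assume $Q_k^i\ge0$ for all $k\in K$, $i\in\{1,2\}$, and that $D_{k+1}$ and $E_k$ are invertible for all $k\in\{0,\dots,T-1\}$. Then the unique open-loop Stackelberg equilibrium strategies and the associated state trajectory of the game can be written as $$\gamma_{k+1}^{i*}(x_0)=u_{k+1}^{i*}=-B_{k+1}^{i'}K_{k+1}^ix_k^*,\quad i\in\{1,2\},\qquad x_{k+1}^*=\Phi_kx_k^*,\quad x_0^*=x_0,\qquad k\in\{0,\dots,T-1\}.$$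
   Context: A prime denotes transpose; for symmetric matrices $\ge0$ means positive semidefinite. States $x_k\in\mathbb R^p$, controls $u_k^i\in\mathbb R^{m_i}$; $A_k,B_k^i,Q_k^i,R_k^{ij}$ are given of appropriate dimensions, with $Q_k^i,R_k^{ij}$ symmetric. Convention: $Q_0^i:=0$. The system in the claim is coupled forward/backward in $k$ ($M$ forward; $P,\Lambda$ backward); the matrices are understood to be a solution of the whole system. Open-loop information pattern: players know only $x_0$, so (for given $x_0$) a strategy of player $i$ is a control sequence $u^i=(u_1^i,\dots,u_T^i)$. Open-loop Stackelberg equilibrium (leader 1): for every $u^1$ let $r(u^1)$ be the unique minimizer of $u^2\mapsto L^2(x_0,u^1,u^2)$; $(u^{1*},u^{2*})$ is an equilibrium if $u^{1*}$ minimizes $u^1\mapsto L^1(x_0,u^1,r(u^1))$ and $u^{2*}=r(u^{1*})$.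
   Formalization: Existence and uniqueness of the equilibrium are asserted only if all R_k^{12} ≥ 0; otherwise the displayed strategies are shown to be an equilibrium if one exists, and the only one if it is unique (for indefinite R_k^{12} none need exist, e.g. T=1, A=B^1=B^2=1, Q^1=0, Q^2=1, R^{12}=-5). *)

theory Defs
  imports "HOL-Analysis.Analysis"
begin

definition psd :: "real^'n^'n \<Rightarrow> bool" where
  "psd S \<longleftrightarrow> transpose S = S \<and> (\<forall>x. 0 \<le> x \<bullet> (S *v x))"

text \<open>For a given initial state, an open-loop strategy is a control sequence indexed by
  \<open>{1..T}\<close>. Extensional functions are used so that uniqueness of a strategy can be
  expressed by equality.\<close>

definition open_loop :: "nat \<Rightarrow> (nat \<Rightarrow> real^'m) set" where
  "open_loop T = ({1..T} \<rightarrow>\<^sub>E UNIV)"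

primrec state :: "(nat \<Rightarrow> real^'p^'p) \<Rightarrow> (nat \<Rightarrow> real^'m^'p) \<Rightarrow> (nat \<Rightarrow> real^'n^'p) \<Rightarrow> real^'p
    \<Rightarrow> (nat \<Rightarrow> real^'m) \<Rightarrow> (nat \<Rightarrow> real^'n) \<Rightarrow> nat \<Rightarrow> real^'p" where
  "state A B1 B2 x0 u1 u2 0 = x0"
| "state A B1 B2 x0 u1 u2 (Suc k) =
     A (Suc k) *v state A B1 B2 x0 u1 u2 k + B1 (Suc k) *v u1 (Suc k) + B2 (Suc k) *v u2 (Suc k)"

text \<open>In \<open>lq_cost T Q R x u v\<close>, \<open>u\<close> is the control of the player whose cost is computed and
  \<open>v\<close> that of the opponent.\<close>

definition lq_cost :: "nat \<Rightarrow> (nat \<Rightarrow> real^'p^'p) \<Rightarrow> (nat \<Rightarrow> real^'n^'n)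
    \<Rightarrow> (nat \<Rightarrow> real^'p) \<Rightarrow> (nat \<Rightarrow> real^'m) \<Rightarrow> (nat \<Rightarrow> real^'n) \<Rightarrow> real" where
  "lq_cost T Q R x u v =
     (\<Sum>k=1..T. 1/2 * (x k \<bullet> (Q k *v x k) + u k \<bullet> u k + v k \<bullet> (R k *v v k)))"

definition reaction :: "'b set \<Rightarrow> ('a \<Rightarrow> 'b \<Rightarrow> real) \<Rightarrow> 'a \<Rightarrow> 'b" where
  "reaction S2 J2 u1 = (THE u2. is_arg_min (J2 u1) (\<lambda>v. v \<in> S2) u2)"

text \<open>The first conjunct makes \<open>reaction\<close> well defined.\<close>

definition stackelberg_equilibrium ::
  "'a set \<Rightarrow> 'b set \<Rightarrow> ('a \<Rightarrow> 'b \<Rightarrow> real) \<Rightarrow> ('a \<Rightarrow> 'b \<Rightarrow> real) \<Rightarrow> 'a \<Rightarrow> 'b \<Rightarrow> bool" where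
  "stackelberg_equilibrium S1 S2 J1 J2 u1 u2 \<longleftrightarrow>
     (\<forall>v1\<in>S1. \<exists>!v2. is_arg_min (J2 v1) (\<lambda>v. v \<in> S2) v2) \<and>
     is_arg_min (\<lambda>v1. J1 v1 (reaction S2 J2 v1)) (\<lambda>v. v \<in> S1) u1 \<and>
     u2 = reaction S2 J2 u1"

definition open_loop_stackelberg ::
  "nat \<Rightarrow> (nat \<Rightarrow> real^'p^'p) \<Rightarrow> (nat \<Rightarrow> real^'m^'p) \<Rightarrow> (nat \<Rightarrow> real^'n^'p)
    \<Rightarrow> (nat \<Rightarrow> real^'p^'p) \<Rightarrow> (nat \<Rightarrow> real^'p^'p) \<Rightarrow> (nat \<Rightarrow> real^'n^'n) \<Rightarrow> (nat \<Rightarrow> real^'m^'m)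
    \<Rightarrow> real^'p \<Rightarrow> (nat \<Rightarrow> real^'m) \<Rightarrow> (nat \<Rightarrow> real^'n) \<Rightarrow> bool" where
  "open_loop_stackelberg T A B1 B2 Q1 Q2 R12 R21 x0 =
     stackelberg_equilibrium (open_loop T) (open_loop T)
       (\<lambda>u1 u2. lq_cost T Q1 R12 (state A B1 B2 x0 u1 u2) u1 u2)
       (\<lambda>u1 u2. lq_cost T Q2 R21 (state A B1 B2 x0 u1 u2) u2 u1)"

text \<open>All matrices inverted by \<open>matrix_inv\<close> below are invertible when the \<open>Q2 k\<close>,
  \<open>k \<in> {1..T}\<close>, are positive semidefinite and all \<open>D (k + 1)\<close> and \<open>E k\<close>, \<open>k < T\<close>,
  are invertible.\<close>

definition coupled_system ::
  "nat \<Rightarrow> (nat \<Rightarrow> real^'p^'p) \<Rightarrow> (nat \<Rightarrow> real^'m^'p) \<Rightarrow> (nat \<Rightarrow> real^'n^'p)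
    \<Rightarrow> (nat \<Rightarrow> real^'p^'p) \<Rightarrow> (nat \<Rightarrow> real^'p^'p) \<Rightarrow> (nat \<Rightarrow> real^'n^'n)
    \<Rightarrow> (nat \<Rightarrow> real^'p^'p) \<Rightarrow> (nat \<Rightarrow> real^'p^'p) \<Rightarrow> (nat \<Rightarrow> real^'p^'p)
    \<Rightarrow> (nat \<Rightarrow> real^'p^'p) \<Rightarrow> (nat \<Rightarrow> real^'p^'p) \<Rightarrow> (nat \<Rightarrow> real^'p^'p) \<Rightarrow> (nat \<Rightarrow> real^'p^'n)
    \<Rightarrow> (nat \<Rightarrow> real^'p^'p) \<Rightarrow> (nat \<Rightarrow> real^'p^'p) \<Rightarrow> bool" where
  "coupled_system T A B1 B2 Q1 Q2 R12 \<Phi> D E P \<Lambda> M N K1 K2 \<longleftrightarrow>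
     P T = Q2 T \<and> \<Lambda> T = Q1 T \<and> M 0 = 0 \<and>
     (\<forall>k<T.
       let j = k + 1;
           A' = A j; b1 = B1 j; b2 = B2 j; q2 = Q2 j; r = R12 j; I = mat 1;
           X = transpose b2 ** q2 ** b2 + mat 1;
           S1 = b1 ** transpose b1;
           S2 = b2 ** transpose b2
       in
         \<Phi> k = matrix_inv (D j) ** E k \<and>
         E k = A' - S1 ** q2 ** matrix_inv (I + S2 ** q2) ** A' ** M k \<and>
         D j = I + S1 ** matrix_inv (I + q2 ** S2) ** \<Lambda> j
                 + S1 ** q2 ** b2 ** matrix_inv X ** r ** transpose b2 ** P j
                 + S2 ** P j \<and>
         P k = Q2 k + transpose A' ** P j ** \<Phi> k \<and>
         \<Lambda> k = Q1 k + transpose A' ** (\<Lambda> j ** \<Phi> k + q2 ** A' ** M k - q2 ** b2 ** N j) \<and>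
         M j = (A' ** M k - b2 ** N j) ** matrix_inv (\<Phi> k) \<and>
         N j = matrix_inv X ** (transpose b2 ** \<Lambda> j ** \<Phi> k - r ** transpose b2 ** K2 j
                 + transpose b2 ** q2 ** A' ** M k) \<and>
         K1 j = matrix_inv (I + q2 ** S2) ** \<Lambda> j ** \<Phi> k
                 + q2 ** b2 ** matrix_inv X ** r ** transpose b2 ** P j ** \<Phi> k
                 + q2 ** matrix_inv (I + S2 ** q2) ** A' ** M k \<and>
         K2 j = P j ** \<Phi> k)"

primrec closed_trajectory :: "(nat \<Rightarrow> real^'p^'p) \<Rightarrow> real^'p \<Rightarrow> nat \<Rightarrow> real^'p" where
  "closed_trajectory \<Phi> x0 0 = x0"
| "closed_trajectory \<Phi> x0 (Suc k) = \<Phi> k *v closed_trajectory \<Phi> x0 k"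

definition candidate_strategy ::
  "nat \<Rightarrow> (nat \<Rightarrow> real^'m^'p) \<Rightarrow> (nat \<Rightarrow> real^'p^'p) \<Rightarrow> (nat \<Rightarrow> real^'p^'p) \<Rightarrow> real^'p
    \<Rightarrow> nat \<Rightarrow> real^'m" where
  "candidate_strategy T B K \<Phi> x0 =
     (\<lambda>k\<in>{1..T}. - ((transpose (B k) ** K k) *v closed_trajectory \<Phi> x0 (k - 1)))"

end

theory Submission
  imports Defs
begin

text \<open>The follower's cost is a strictly convex, coercive quadratic in his controls, so his reaction is
  characterised by stationarity and is affine in the leader's controls. Hence, along any line through
  a pair stationary for both players, the leader's reduced cost is a constant plus \<open>t\<^sup>2\<close> times the
  second variation. This second variation is nonnegative as soon as some equilibrium exists, and
  positive definite when the \<open>R12 k\<close> are positive semidefinite. The candidate is stationary because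
  the coupled system is the adjoint system of both problems: by the Woodbury identity,
  \<open>K1 = (\<Lambda> + Q2 M) \<Phi>\<close> at every stage.\<close>

section \<open>Scalar quadratics and matrix inverses\<close>

lemma linear_coeff_zero_if_nonneg:
  fixes a b :: real
  assumes "\<And>t. 0 \<le> t * a + t\<^sup>2 * b"
  shows "a = 0"
proof (rule ccontr)
  assume a: "a \<noteq> 0"
  \<comment> \<open>Any positive \<open>c\<close> above \<open>b\<close> serves: at
    \<open>t = - a / c\<close> the quadratic equals \<open>a\<^sup>2 / c\<^sup>2 * (b - c)\<close>,
    which is negative.\<close>
  define c where "c = \<bar>b\<bar> + 1"
  have c: "c > 0" "b < c" by (auto simp: c_def)
  have "0 \<le> (- a / c) * a + (- a / c)\<^sup>2 * b" by (rule assms)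
  also have "\<dots> = a\<^sup>2 / c\<^sup>2 * (b - c)"
    using c by (simp add: field_simps power2_eq_square)
  also have "\<dots> < 0"
    using a c by (intro mult_pos_neg) auto
  finally show False by simp
qed

lemma quadratic_coeff_nonneg_if_bdd_below:
  fixes b c :: real
  assumes "\<And>t. c \<le> t\<^sup>2 * b"
  shows "0 \<le> b"
proof (rule ccontr)
  assume "\<not> 0 \<le> b"
  then have b: "b < 0" by simp
  \<comment> \<open>Chosen so that \<open>t\<^sup>2 * b = - (\<bar>c\<bar> + 1)\<close>, which is
    strictly below \<open>c\<close>.\<close>
  define t where "t = sqrt ((\<bar>c\<bar> + 1) / - b)"
  have "t\<^sup>2 = (\<bar>c\<bar> + 1) / - b"
    unfolding t_def using b by (intro real_sqrt_pow2 divide_nonneg_pos) auto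
  then have "t\<^sup>2 * b = - (\<bar>c\<bar> + 1)" using b by (simp add: field_simps)
  with assms[of t] show False by simp
qed

lemma symmetric_inner_commute:
  fixes S :: "real^'n^'n"
  assumes "transpose S = S"
  shows "x \<bullet> (S *v y) = y \<bullet> (S *v x)"
proof -
  have "x \<bullet> (S *v y) = (transpose S *v x) \<bullet> y" by (simp add: dot_lmul_matrix)
  then show ?thesis using assms by (simp add: inner_commute)
qed

lemma
  fixes A :: "real^'n^'n"
  assumes "invertible A"
  shows matrix_inv_left: "matrix_inv A ** A = mat 1"
    and matrix_inv_right: "A ** matrix_inv A = mat 1"
  using someI_ex[OF assms[unfolded invertible_def]] by (simp_all add: matrix_inv_def)

text \<open>For square matrices a right inverse is two-sided, so a single product identifies
  \<open>matrix_inv\<close>.\<close>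

lemma matrix_inv_eqI:
  fixes A B :: "real^'n^'n"
  assumes "A ** B = mat 1"
  shows "matrix_inv A = B"
proof -
  have "invertible A" using assms by (simp add: invertible_right_inverse) blast
  then have "matrix_inv A ** A = mat 1" by (rule matrix_inv_left)
  then have "matrix_inv A ** (A ** B) = B" by (simp add: matrix_mul_assoc)
  with assms show ?thesis by simp
qed

lemma matrix_inv_vector:
  fixes A :: "real^'n^'n"
  assumes "invertible A"
  shows "A *v (matrix_inv A *v x) = x" "matrix_inv A *v (A *v x) = x"
  using assms by (simp_all add: matrix_vector_mul_assoc matrix_inv_left matrix_inv_right)

text \<open>The quadratic form at \<open>x\<close> is that of \<open>q\<close> at
  \<open>b *v x\<close> plus the squared norm of \<open>x\<close>; hence the kernel is
  trivial.\<close>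

lemma invertible_gram_plus_id:
  fixes b :: "real^'m^'p"
  assumes "psd q"
  shows "invertible (transpose b ** q ** b + mat 1)"
proof -
  have "x = 0" if "(transpose b ** q ** b + mat 1) *v x = 0" for x :: "real^'m"
  proof -
    have "x \<bullet> (transpose b *v z) = (b *v x) \<bullet> z" for z
      by (metis transpose_matrix_vector dot_lmul_matrix inner_commute)
    then have "x \<bullet> ((transpose b ** q ** b + mat 1) *v x) = (b *v x) \<bullet> (q *v (b *v x)) + x \<bullet> x"
      by (simp add: matrix_vector_mult_add_rdistrib matrix_vector_mul_assoc[symmetric]
          inner_add_right del: transpose_matrix_vector)
    moreover have "0 \<le> (b *v x) \<bullet> (q *v (b *v x))" using assms by (simp add: psd_def)
    ultimately have "x \<bullet> x \<le> 0" using that by simp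
    then show "x = 0" by (metis inner_ge_zero inner_eq_zero_iff order_antisym)
  qed
  then show ?thesis
    by (simp add: invertible_left_inverse matrix_left_invertible_ker)
qed

text \<open>The Woodbury identity reduces both inverses in the coupled system to that of \<open>X\<close>.\<close>

lemma woodbury_vector:
  fixes b :: "real^'m^'p" and q :: "real^'p^'p"
  defines "X \<equiv> transpose b ** q ** b + mat 1"
  assumes "psd q"
  shows "matrix_inv (mat 1 + q ** (b ** transpose b)) *v x
      = x - q *v (b *v (matrix_inv X *v (transpose b *v x)))" (is ?left)
    and "matrix_inv (mat 1 + (b ** transpose b) ** q) *v x
      = x - b *v (matrix_inv X *v (transpose b *v (q *v x)))" (is ?right)
proof -
  have X: "X *v (matrix_inv X *v z) = z" for z
    using invertible_gram_plus_id[OF assms(2), of b] by (simp add: X_def matrix_inv_vector)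
  \<comment> \<open>\<open>X\<close> minus the identity is \<open>transpose b ** q ** b\<close>, so
    this product collapses against \<open>matrix_inv X\<close>. Both verifications below rest on
    this rewriting.\<close>
  have X': "transpose b *v (q *v (b *v (matrix_inv X *v z))) = z - matrix_inv X *v z" for z
    using X[of z] by (simp add: X_def matrix_vector_mult_add_rdistrib
        matrix_vector_mul_assoc[symmetric] algebra_simps del: transpose_matrix_vector)
  have "(mat 1 + q ** (b ** transpose b)) ** (mat 1 - q ** b ** matrix_inv X ** transpose b) = mat 1"
    by (rule matrix_eq[THEN iffD2])
      (simp add: matrix_vector_mult_add_rdistrib matrix_vector_mult_diff_rdistrib
        matrix_vector_mul_assoc[symmetric] matrix_vector_mult_diff_distrib
        matrix_vector_right_distrib X' del: transpose_matrix_vector)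
  from matrix_inv_eqI[OF this] show ?left
    by (simp add: matrix_vector_mult_diff_rdistrib matrix_vector_mul_assoc[symmetric])
  have "(mat 1 + (b ** transpose b) ** q) ** (mat 1 - b ** matrix_inv X ** transpose b ** q) = mat 1"
    by (rule matrix_eq[THEN iffD2])
      (simp add: matrix_vector_mult_add_rdistrib matrix_vector_mult_diff_rdistrib
        matrix_vector_mul_assoc[symmetric] matrix_vector_mult_diff_distrib
        matrix_vector_right_distrib X' del: transpose_matrix_vector)
  from matrix_inv_eqI[OF this] show ?right
    by (simp add: matrix_vector_mult_diff_rdistrib matrix_vector_mul_assoc[symmetric])
qed

subsection \<open>Linear dynamics and quadratic costs\<close>

text \<open>Summation by parts: \<open>p\<close> is the costate driven by the source
  \<open>g\<close>, and \<open>p k \<bullet> y k\<close> telescopes because the transposed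
  \<open>A\<close> of the costate recursion meets \<open>A\<close> of the state recursion. A
  functional of the state response becomes one of the input \<open>b\<close>.\<close>

lemma sum_adjoint:
  fixes p g y b :: "nat \<Rightarrow> real^'p"
  assumes p: "\<And>k. 1 \<le> k \<Longrightarrow> k < T \<Longrightarrow> p k = g k + transpose (A (Suc k)) *v p (Suc k)"
    and pT: "p T = g T"
    and y0: "y 0 = 0"
    and y: "\<And>k. k < T \<Longrightarrow> y (Suc k) = A (Suc k) *v y k + b (Suc k)"
  shows "(\<Sum>k=1..T. g k \<bullet> y k) = (\<Sum>k=1..T. p k \<bullet> b k)"
proof (cases "T = 0")
  case False
  \<comment> \<open>The source sum stops at \<open>n - 1\<close>, with boundary term
    \<open>p n \<bullet> y n\<close>; at \<open>n = T\<close> this is the missing summand because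
    \<open>p T = g T\<close>.\<close>
  have "(\<Sum>k=1..n. p k \<bullet> b k) = (\<Sum>k=1..<n. g k \<bullet> y k) + p n \<bullet> y n" if "n \<le> T" for n
    using that
  proof (induction n)
    case 0
    then show ?case using y0 by simp
  next
    case (Suc n)
    have 1: "p (Suc n) \<bullet> y (Suc n)
        = (transpose (A (Suc n)) *v p (Suc n)) \<bullet> y n + p (Suc n) \<bullet> b (Suc n)"
      using y[of n] Suc.prems by (simp add: inner_add_right dot_lmul_matrix)
    show ?case
    proof (cases "n = 0")
      case True
      then show ?thesis using 1 y0 by simp
    next
      case False
      then have "p n = g n + transpose (A (Suc n)) *v p (Suc n)" using p[of n] Suc.prems by simp
      with 1 Suc False show ?thesis by (simp add: inner_add_left)
    qed
  qed
  from this[of T] show ?thesis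
    using False pT by (simp add: sum.last_plus atLeastLessThanSuc_atLeastAtMost[symmetric])
qed simp

lemma state_cong:
  assumes "\<And>j. 1 \<le> j \<Longrightarrow> j \<le> k \<Longrightarrow> u j = u' j" "\<And>j. 1 \<le> j \<Longrightarrow> j \<le> k \<Longrightarrow> v j = v' j"
  shows "state A B1 B2 x0 u v k = state A B1 B2 x0 u' v' k"
  using assms by (induction k) auto

text \<open>Superposition, jointly in the initial state and both controls; \<open>y0 = 0\<close>
  isolates the effect of a deviation in the controls.\<close>

lemma state_add_scaleR:
  "state A B1 B2 (x0 + t *\<^sub>R y0) (\<lambda>k. u k + t *\<^sub>R h k) (\<lambda>k. v k + t *\<^sub>R w k) k
    = state A B1 B2 x0 u v k + t *\<^sub>R state A B1 B2 y0 h w k"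
  by (induction k)
    (simp_all add: matrix_vector_right_distrib matrix_vector_mult_scaleR scaleR_add_right)

lemma lq_cost_cong:
  assumes "\<And>k. k \<in> {1..T} \<Longrightarrow> x k = x' k" "\<And>k. k \<in> {1..T} \<Longrightarrow> u k = u' k"
    "\<And>k. k \<in> {1..T} \<Longrightarrow> v k = v' k"
  shows "lq_cost T Q R x u v = lq_cost T Q R x' u' v'"
  unfolding lq_cost_def using assms by (intro sum.cong) auto

text \<open>Symmetry merges the two cross terms. Since the cost is a homogeneous quadratic form, the
  expansion is exact and its second-order coefficient is the cost of the deviation itself.\<close>

lemma lq_cost_expand:
  assumes "\<And>k. k \<in> {1..T} \<Longrightarrow> transpose (Q k) = Q k" "\<And>k. k \<in> {1..T} \<Longrightarrow> transpose (R k) = R k"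
  shows "lq_cost T Q R (\<lambda>k. x k + t *\<^sub>R y k) (\<lambda>k. u k + t *\<^sub>R h k) (\<lambda>k. v k + t *\<^sub>R w k)
    = lq_cost T Q R x u v + t * (\<Sum>k=1..T. x k \<bullet> (Q k *v y k) + u k \<bullet> h k + v k \<bullet> (R k *v w k))
      + t\<^sup>2 * lq_cost T Q R y h w"
  unfolding lq_cost_def sum_distrib_left sum.distrib[symmetric]
proof (rule sum.cong[OF refl])
  fix k assume k: "k \<in> {1..T}"
  have "y k \<bullet> (Q k *v x k) = x k \<bullet> (Q k *v y k)" "w k \<bullet> (R k *v v k) = v k \<bullet> (R k *v w k)"
    using assms[OF k] by (simp_all add: symmetric_inner_commute)
  then show "1/2 * ((x k + t *\<^sub>R y k) \<bullet> (Q k *v (x k + t *\<^sub>R y k))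
      + (u k + t *\<^sub>R h k) \<bullet> (u k + t *\<^sub>R h k) + (v k + t *\<^sub>R w k) \<bullet> (R k *v (v k + t *\<^sub>R w k)))
    = 1/2 * (x k \<bullet> (Q k *v x k) + u k \<bullet> u k + v k \<bullet> (R k *v v k))
      + t * (x k \<bullet> (Q k *v y k) + u k \<bullet> h k + v k \<bullet> (R k *v w k))
      + t\<^sup>2 * (1/2 * (y k \<bullet> (Q k *v y k) + h k \<bullet> h k + w k \<bullet> (R k *v w k)))"
    by (simp add: matrix_vector_right_distrib matrix_vector_mult_scaleR inner_add_left
        inner_add_right inner_commute[of "h k" "u k"] algebra_simps power2_eq_square)
qed

text \<open>The state terms are dropped as nonnegative; the opponent's term stays because no sign of
  \<open>R\<close> is assumed.\<close>

lemma lq_cost_ge: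
  assumes "\<And>k. k \<in> {1..T} \<Longrightarrow> psd (Q k)"
  shows "(\<Sum>k=1..T. 1/2 * (u k \<bullet> u k)) + (\<Sum>k=1..T. 1/2 * (v k \<bullet> (R k *v v k)))
    \<le> lq_cost T Q R x u v"
  unfolding lq_cost_def sum.distrib[symmetric]
  using assms by (intro sum_mono) (simp add: psd_def)

lemma sum_half_inner_eq_0_iff:
  fixes u :: "nat \<Rightarrow> real^'m"
  shows "(\<Sum>k=1..T. 1/2 * (u k \<bullet> u k)) \<le> 0 \<longleftrightarrow> (\<forall>k\<in>{1..T}. u k = 0)"
proof -
  have "(\<Sum>k=1..T. 1/2 * (u k \<bullet> u k)) \<le> 0 \<longleftrightarrow> (\<Sum>k=1..T. 1/2 * (u k \<bullet> u k)) = 0"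
    using sum_nonneg[of "{1..T}" "\<lambda>k. 1/2 * (u k \<bullet> u k)"] by auto
  also have "\<dots> \<longleftrightarrow> (\<forall>k\<in>{1..T}. u k = 0)"
    by (subst sum_nonneg_eq_0_iff) auto
  finally show ?thesis .
qed

lemma open_loop_eqI:
  assumes "u \<in> open_loop T" "v \<in> open_loop T" "\<And>k. k \<in> {1..T} \<Longrightarrow> u k = v k"
  shows "u = v"
  using assms unfolding open_loop_def by (metis PiE_ext)

lemma restrict_open_loop: "restrict u {1..T} \<in> open_loop T"
  by (simp add: open_loop_def)

declare restrict_open_loop [simplified, simp]

text \<open>Tychonoff's theorem, once the extensional product is seen as a product over all indices
  with factors \<open>{undefined}\<close> outside \<open>{1..T}\<close>.\<close>

lemma compact_PiE_cball:
  "compact (PiE {1..T} (\<lambda>_. cball 0 r) :: (nat \<Rightarrow> real^'m) set)"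
proof -
  have eq: "PiE {1..T} (\<lambda>_. cball 0 r)
      = (PiE UNIV (\<lambda>i. if i \<in> {1..T} then cball 0 r else {undefined}) :: (nat \<Rightarrow> real^'m) set)"
    by (auto simp: PiE_def Pi_def extensional_def split: if_splits)
  have "compactin (product_topology (\<lambda>_. euclidean) UNIV)
      (PiE UNIV (\<lambda>i. if i \<in> {1..T} then cball 0 r else {undefined}) :: (nat \<Rightarrow> real^'m) set)"
    unfolding compactin_PiE by simp
  then show ?thesis unfolding eq euclidean_product_topology by simp
qed

lemma continuous_on_state:
  "continuous_on S (\<lambda>v. state A B1 B2 x0 u v k)"
proof (induction k)
  case (Suc k)
  have "continuous_on S (\<lambda>v :: nat \<Rightarrow> real^_. v (Suc k))"
    by (rule continuous_on_product_coordinates[THEN continuous_on_subset]) simp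
  with Suc show ?case
    by (auto intro!: continuous_intros bounded_linear.continuous_on[OF matrix_vector_mul_bounded_linear])
qed simp

subsection \<open>Best responses and stationary pairs\<close>

locale lq_game =
  fixes T :: nat
    and A :: "nat \<Rightarrow> real^'p^'p"
    and B1 :: "nat \<Rightarrow> real^'m1^'p" and B2 :: "nat \<Rightarrow> real^'m2^'p"
    and Q1 Q2 :: "nat \<Rightarrow> real^'p^'p"
    and R12 :: "nat \<Rightarrow> real^'m2^'m2" and R21 :: "nat \<Rightarrow> real^'m1^'m1"
  assumes R12_sym: "k \<in> {1..T} \<Longrightarrow> transpose (R12 k) = R12 k"
    and R21_sym: "k \<in> {1..T} \<Longrightarrow> transpose (R21 k) = R21 k"
    and Q1_psd: "k \<in> {1..T} \<Longrightarrow> psd (Q1 k)"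
    and Q2_psd: "k \<in> {1..T} \<Longrightarrow> psd (Q2 k)"
begin

abbreviation traj :: "real^'p \<Rightarrow> (nat \<Rightarrow> real^'m1) \<Rightarrow> (nat \<Rightarrow> real^'m2) \<Rightarrow> nat \<Rightarrow> real^'p" where
  "traj \<equiv> state A B1 B2"

definition leader_cost :: "real^'p \<Rightarrow> (nat \<Rightarrow> real^'m1) \<Rightarrow> (nat \<Rightarrow> real^'m2) \<Rightarrow> real" where
  "leader_cost x0 u v = lq_cost T Q1 R12 (traj x0 u v) u v"

definition follower_cost :: "real^'p \<Rightarrow> (nat \<Rightarrow> real^'m1) \<Rightarrow> (nat \<Rightarrow> real^'m2) \<Rightarrow> real" where
  "follower_cost x0 u v = lq_cost T Q2 R21 (traj x0 u v) v u"

abbreviation follower_reaction :: "real^'p \<Rightarrow> (nat \<Rightarrow> real^'m1) \<Rightarrow> (nat \<Rightarrow> real^'m2)" where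
  "follower_reaction x0 \<equiv> reaction (open_loop T) (follower_cost x0)"

text \<open>The first variation of \<open>follower_cost\<close> vanishes in every direction
  \<open>z\<close>; \<open>traj 0 (\<lambda>_. 0) z\<close> is the state change caused by
  \<open>z\<close>. The initial state is a parameter so that differences of stationary triples,
  which start at \<open>0\<close>, are covered.\<close>

definition follower_stationary :: "real^'p \<Rightarrow> (nat \<Rightarrow> real^'m1) \<Rightarrow> (nat \<Rightarrow> real^'m2) \<Rightarrow> bool" where
  "follower_stationary x0 u v \<longleftrightarrow>
     (\<forall>z. (\<Sum>k=1..T. traj x0 u v k \<bullet> (Q2 k *v traj 0 (\<lambda>_. 0) z k) + v k \<bullet> z k) = 0)"

lemma traj_cong:
  assumes "\<And>k. k \<in> {1..T} \<Longrightarrow> u k = u' k" "\<And>k. k \<in> {1..T} \<Longrightarrow> v k = v' k" "k \<le> T"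
  shows "traj x0 u v k = traj x0 u' v' k"
  using assms by (intro state_cong) auto

lemma cost_cong:
  assumes "\<And>k. k \<in> {1..T} \<Longrightarrow> u k = u' k" "\<And>k. k \<in> {1..T} \<Longrightarrow> v k = v' k"
  shows "leader_cost x0 u v = leader_cost x0 u' v'" "follower_cost x0 u v = follower_cost x0 u' v'"
  unfolding leader_cost_def follower_cost_def using assms
  by (auto intro!: lq_cost_cong traj_cong)

lemma follower_stationary_cong:
  assumes "\<And>k. k \<in> {1..T} \<Longrightarrow> u k = u' k" "\<And>k. k \<in> {1..T} \<Longrightarrow> v k = v' k"
  shows "follower_stationary x0 u v \<longleftrightarrow> follower_stationary x0 u' v'"
proof -
  have "traj x0 u v k = traj x0 u' v' k" if "k \<in> {1..T}" for k
    using assms that by (intro traj_cong) auto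
  then show ?thesis unfolding follower_stationary_def using assms by simp
qed

text \<open>The first variation is linear in the triple of initial state and controls; this is what
  makes the reaction affine.\<close>

lemma follower_stationary_add_scaleR:
  assumes "follower_stationary x0 u v" "follower_stationary y0 h w"
  shows "follower_stationary (x0 + t *\<^sub>R y0) (\<lambda>k. u k + t *\<^sub>R h k) (\<lambda>k. v k + t *\<^sub>R w k)"
  unfolding follower_stationary_def state_add_scaleR
proof
  fix z
  let ?y = "traj 0 (\<lambda>_. 0) z"
  have "(\<Sum>k=1..T. (traj x0 u v k + t *\<^sub>R traj y0 h w k) \<bullet> (Q2 k *v ?y k) + (v k + t *\<^sub>R w k) \<bullet> z k)
    = (\<Sum>k=1..T. traj x0 u v k \<bullet> (Q2 k *v ?y k) + v k \<bullet> z k)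
      + t * (\<Sum>k=1..T. traj y0 h w k \<bullet> (Q2 k *v ?y k) + w k \<bullet> z k)"
    unfolding sum_distrib_left sum.distrib[symmetric]
    by (intro sum.cong) (auto simp: inner_add_left algebra_simps)
  also have "\<dots> = 0" using assms by (simp add: follower_stationary_def)
  finally show "(\<Sum>k=1..T. (traj x0 u v k + t *\<^sub>R traj y0 h w k) \<bullet> (Q2 k *v ?y k)
      + (v k + t *\<^sub>R w k) \<bullet> z k) = 0" .
qed

lemma follower_cost_expand:
  "follower_cost x0 u (\<lambda>k. v k + t *\<^sub>R z k) = follower_cost x0 u v
    + t * (\<Sum>k=1..T. traj x0 u v k \<bullet> (Q2 k *v traj 0 (\<lambda>_. 0) z k) + v k \<bullet> z k)
    + t\<^sup>2 * follower_cost 0 (\<lambda>_. 0) z"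
proof -
  have "traj x0 u (\<lambda>k. v k + t *\<^sub>R z k) = (\<lambda>k. traj x0 u v k + t *\<^sub>R traj 0 (\<lambda>_. 0) z k)"
    using state_add_scaleR[of A B1 B2 x0 t 0 u "\<lambda>_. 0" v z] by auto
  then show ?thesis
    using lq_cost_expand[of T Q2 R21 "traj x0 u v" t "traj 0 (\<lambda>_. 0) z" v z u "\<lambda>_. 0"] Q2_psd R21_sym
    by (simp add: follower_cost_def psd_def)
qed

lemma leader_cost_expand:
  "leader_cost x0 (\<lambda>k. u k + t *\<^sub>R h k) (\<lambda>k. v k + t *\<^sub>R w k) = leader_cost x0 u v
    + t * (\<Sum>k=1..T. traj x0 u v k \<bullet> (Q1 k *v traj 0 h w k) + u k \<bullet> h k + v k \<bullet> (R12 k *v w k))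
    + t\<^sup>2 * leader_cost 0 h w"
proof -
  have "traj x0 (\<lambda>k. u k + t *\<^sub>R h k) (\<lambda>k. v k + t *\<^sub>R w k) = (\<lambda>k. traj x0 u v k + t *\<^sub>R traj 0 h w k)"
    using state_add_scaleR[of A B1 B2 x0 t 0 u h v w] by auto
  then show ?thesis
    using lq_cost_expand[of T Q1 R12 "traj x0 u v" t "traj 0 h w" u h v w] Q1_psd R12_sym
    by (simp add: leader_cost_def psd_def)
qed

lemma follower_cost_ge:
  "(\<Sum>k=1..T. 1/2 * (v k \<bullet> v k)) + (\<Sum>k=1..T. 1/2 * (u k \<bullet> (R21 k *v u k))) \<le> follower_cost x0 u v"
  unfolding follower_cost_def by (intro lq_cost_ge Q2_psd)

lemma follower_cost_homogeneous_ge: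
  "(\<Sum>k=1..T. 1/2 * (z k \<bullet> z k)) \<le> follower_cost 0 (\<lambda>_. 0) z"
  using follower_cost_ge[of z "\<lambda>_. 0" 0] by simp

text \<open>Costs ignore values outside \<open>{1..T}\<close>, so minimality may be tested against
  pointwise perturbations that are not extensional.\<close>

lemma is_arg_min_open_loop_iff:
  "is_arg_min (follower_cost x0 u) (\<lambda>v. v \<in> open_loop T) v
    \<longleftrightarrow> v \<in> open_loop T \<and> (\<forall>v'. follower_cost x0 u v \<le> follower_cost x0 u v')"
proof -
  have "follower_cost x0 u v' = follower_cost x0 u (restrict v' {1..T})" for v'
    by (intro cost_cong) auto
  then show ?thesis unfolding is_arg_min_linorder
    by (metis restrict_open_loop)
qed

text \<open>By the exact expansion, minimality kills the linear coefficient; conversely, at a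
  stationary control only the nonnegative second variation remains.\<close>

lemma follower_is_arg_min_iff:
  "is_arg_min (follower_cost x0 u) (\<lambda>v. v \<in> open_loop T) v
    \<longleftrightarrow> v \<in> open_loop T \<and> follower_stationary x0 u v"
proof -
  have "follower_stationary x0 u v" if min: "\<And>v'. follower_cost x0 u v \<le> follower_cost x0 u v'"
    unfolding follower_stationary_def
  proof
    fix z
    show "(\<Sum>k=1..T. traj x0 u v k \<bullet> (Q2 k *v traj 0 (\<lambda>_. 0) z k) + v k \<bullet> z k) = 0"
    proof (rule linear_coeff_zero_if_nonneg)
      fix t
      show "0 \<le> t * (\<Sum>k=1..T. traj x0 u v k \<bullet> (Q2 k *v traj 0 (\<lambda>_. 0) z k) + v k \<bullet> z k)
          + t\<^sup>2 * follower_cost 0 (\<lambda>_. 0) z"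
        using min[of "\<lambda>k. v k + t *\<^sub>R z k"] unfolding follower_cost_expand by simp
    qed
  qed
  moreover have "follower_cost x0 u v \<le> follower_cost x0 u v'" if "follower_stationary x0 u v" for v'
  proof -
    have "0 \<le> follower_cost 0 (\<lambda>_. 0) (\<lambda>k. v' k - v k)"
      using follower_cost_homogeneous_ge[of "\<lambda>k. v' k - v k"]
      by (rule order_trans[rotated]) (simp add: sum_nonneg)
    then show ?thesis
      using follower_cost_expand[of x0 u v 1 "\<lambda>k. v' k - v k"] that
      by (simp add: follower_stationary_def)
  qed
  ultimately show ?thesis unfolding is_arg_min_open_loop_iff by blast
qed

text \<open>Both controls are minimizers, so the second variation along their difference is at most
  \<open>0\<close>, yet it dominates half the squared norm.\<close>

lemma follower_stationary_unique:
  assumes "v \<in> open_loop T" "follower_stationary x0 u v"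
    and "v' \<in> open_loop T" "follower_stationary x0 u v'"
  shows "v' = v"
proof (rule open_loop_eqI[OF assms(3,1)])
  let ?z = "\<lambda>k. v' k - v k"
  have "follower_cost x0 u v' \<le> follower_cost x0 u v"
    using assms follower_is_arg_min_iff is_arg_min_open_loop_iff by metis
  then have "follower_cost 0 (\<lambda>_. 0) ?z \<le> 0"
    using follower_cost_expand[of x0 u v 1 ?z] assms by (simp add: follower_stationary_def)
  with follower_cost_homogeneous_ge[of ?z] have "\<forall>k\<in>{1..T}. ?z k = 0"
    by (subst sum_half_inner_eq_0_iff[symmetric]) linarith
  then show "v' k = v k" if "k \<in> {1..T}" for k using that by simp
qed

section \<open>Existence and affine form of the follower's reaction\<close>

lemma continuous_on_follower_cost: "continuous_on S (follower_cost x0 u)"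
proof -
  have "continuous_on S (\<lambda>v :: nat \<Rightarrow> real^'m2. v k)" for k
    by (rule continuous_on_product_coordinates[THEN continuous_on_subset]) simp
  then show ?thesis
    unfolding follower_cost_def[abs_def] lq_cost_def
    by (auto intro!: continuous_intros continuous_on_state bounded_linear.continuous_on[OF matrix_vector_mul_bounded_linear])
qed

lemma follower_minimizer_exists:
  "\<exists>v. is_arg_min (follower_cost x0 u) (\<lambda>v. v \<in> open_loop T) v"
proof -
  \<comment> \<open>Coercivity: \<open>j\<close> is the cost of the zero control, and the cost of
    \<open>v'\<close> is at least \<open>c\<close> plus half its squared norm. A component outside
    the ball of radius \<open>r\<close> already contributes more than
    \<open>\<bar>j - c\<bar>\<close>, so the minimum over the compact set is global.\<close>
  define c where "c = (\<Sum>k=1..T. 1/2 * (u k \<bullet> (R21 k *v u k)))"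
  define j where "j = follower_cost x0 u (restrict (\<lambda>_. 0) {1..T})"
  define r where "r = sqrt (2 * \<bar>j - c\<bar>)"
  let ?K = "PiE {1..T} (\<lambda>_. cball 0 r) :: (nat \<Rightarrow> real^'m2) set"
  have r: "r \<ge> 0" by (simp add: r_def)
  then have zero: "restrict (\<lambda>_. 0) {1..T} \<in> ?K" by auto
  then have "?K \<noteq> {}" by blast
  then obtain v where v: "v \<in> ?K" "\<And>v'. v' \<in> ?K \<Longrightarrow> follower_cost x0 u v \<le> follower_cost x0 u v'"
    using continuous_attains_inf[of ?K "follower_cost x0 u", OF compact_PiE_cball _ continuous_on_follower_cost]
    by metis
  have "follower_cost x0 u v \<le> follower_cost x0 u v'" if v': "v' \<in> open_loop T" for v'
  proof (cases "v' \<in> ?K")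
    case False
    then obtain k where k: "k \<in> {1..T}" "r < norm (v' k)"
      using v' by (force simp: open_loop_def PiE_def Pi_def)
    have "r\<^sup>2 < (norm (v' k))\<^sup>2" using k(2) r by (intro power_strict_mono) auto
    then have "\<bar>j - c\<bar> < 1/2 * (v' k \<bullet> v' k)" by (simp add: r_def power2_norm_eq_inner)
    also have "\<dots> \<le> (\<Sum>k=1..T. 1/2 * (v' k \<bullet> v' k))"
      using k(1) by (intro member_le_sum) auto
    finally have "j \<le> follower_cost x0 u v'"
      using follower_cost_ge[of v' u x0] by (simp add: c_def)
    moreover have "follower_cost x0 u v \<le> j" unfolding j_def by (rule v(2)[OF zero])
    ultimately show ?thesis by simp
  qed (rule v(2))
  moreover have "v \<in> open_loop T" using v(1) by (auto simp: open_loop_def PiE_def)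
  ultimately show ?thesis unfolding is_arg_min_linorder by blast
qed

lemma follower_minimizer_ex1:
  "\<exists>!v. is_arg_min (follower_cost x0 u) (\<lambda>v. v \<in> open_loop T) v"
  using follower_minimizer_exists follower_stationary_unique follower_is_arg_min_iff by metis

lemma follower_reaction_stationary:
  "follower_reaction x0 u \<in> open_loop T" "follower_stationary x0 u (follower_reaction x0 u)"
  using theI'[OF follower_minimizer_ex1, of x0 u]
  by (simp_all add: reaction_def follower_is_arg_min_iff)

lemma follower_reaction_eqI:
  assumes "v \<in> open_loop T" "follower_stationary x0 u v"
  shows "follower_reaction x0 u = v"
  using assms follower_reaction_stationary follower_stationary_unique by metis

text \<open>Subtracting two stationary triples cancels \<open>x0\<close> and leaves a homogeneous
  one; adding multiples of it preserves stationarity, and uniqueness identifies the result with the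
  reaction.\<close>

lemma follower_reaction_line:
  assumes h: "h = (\<lambda>k. u' k - u k)"
    and w: "w = (\<lambda>k. follower_reaction x0 u' k - follower_reaction x0 u k)"
  shows "follower_stationary 0 h w"
    and "follower_reaction x0 (\<lambda>k\<in>{1..T}. u k + t *\<^sub>R h k)
      = (\<lambda>k\<in>{1..T}. follower_reaction x0 u k + t *\<^sub>R w k)"
proof -
  note stat = follower_reaction_stationary(2)
  show hw: "follower_stationary 0 h w"
    using follower_stationary_add_scaleR[OF stat[of x0 u'] stat[of x0 u], of "-1"]
    by (simp add: h w)
  have "follower_stationary x0 (\<lambda>k. u k + t *\<^sub>R h k) (\<lambda>k. follower_reaction x0 u k + t *\<^sub>R w k)"
    using follower_stationary_add_scaleR[OF stat[of x0 u] hw, of t] by simp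
  then have "follower_stationary x0 (\<lambda>k\<in>{1..T}. u k + t *\<^sub>R h k)
      (\<lambda>k\<in>{1..T}. follower_reaction x0 u k + t *\<^sub>R w k)"
    by (subst follower_stationary_cong) auto
  then show "follower_reaction x0 (\<lambda>k\<in>{1..T}. u k + t *\<^sub>R h k)
      = (\<lambda>k\<in>{1..T}. follower_reaction x0 u k + t *\<^sub>R w k)"
    by (intro follower_reaction_eqI) auto
qed

text \<open>Only directions tangent to the graph of the reaction are tested: \<open>w\<close> is the
  follower's linear response to \<open>h\<close>.\<close>

definition leader_stationary :: "real^'p \<Rightarrow> (nat \<Rightarrow> real^'m1) \<Rightarrow> (nat \<Rightarrow> real^'m2) \<Rightarrow> bool" where
  "leader_stationary x0 u v \<longleftrightarrow> (\<forall>h w. follower_stationary 0 h w \<longrightarrow>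
     (\<Sum>k=1..T. traj x0 u v k \<bullet> (Q1 k *v traj 0 h w k) + u k \<bullet> h k + v k \<bullet> (R12 k *v w k)) = 0)"

abbreviation (input) equilibrium :: "real^'p \<Rightarrow> (nat \<Rightarrow> real^'m1) \<Rightarrow> (nat \<Rightarrow> real^'m2) \<Rightarrow> bool" where
  "equilibrium \<equiv> open_loop_stackelberg T A B1 B2 Q1 Q2 R12 R21"

lemma equilibrium_iff:
  "equilibrium x0 u v \<longleftrightarrow> u \<in> open_loop T \<and> v = follower_reaction x0 u \<and>
    (\<forall>u'\<in>open_loop T. leader_cost x0 u (follower_reaction x0 u) \<le> leader_cost x0 u' (follower_reaction x0 u'))"
  using follower_minimizer_ex1
  unfolding open_loop_stackelberg_def stackelberg_equilibrium_def is_arg_min_linorder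
    leader_cost_def[abs_def] follower_cost_def[abs_def]
  by auto

section \<open>The leader's reduced cost around a stationary pair\<close>

context
  fixes x0 :: "real^'p" and u :: "nat \<Rightarrow> real^'m1" and v :: "nat \<Rightarrow> real^'m2"
  assumes u: "u \<in> open_loop T" and v: "v \<in> open_loop T"
    and fol: "follower_stationary x0 u v" and lead: "leader_stationary x0 u v"
begin

lemma reaction_stationary_pair: "follower_reaction x0 u = v"
  using v fol by (rule follower_reaction_eqI)

text \<open>The reaction stays on the line through \<open>v\<close> with direction \<open>w\<close>,
  and leader stationarity removes the linear term.\<close>

lemma leader_cost_line:
  fixes u' :: "nat \<Rightarrow> real^'m1" and t :: real
  defines "h \<equiv> \<lambda>k. u' k - u k" and "w \<equiv> \<lambda>k. follower_reaction x0 u' k - v k"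
    and "ut \<equiv> \<lambda>k\<in>{1..T}. u k + t *\<^sub>R (u' k - u k)"
  shows "leader_cost x0 ut (follower_reaction x0 ut) = leader_cost x0 u v + t\<^sup>2 * leader_cost 0 h w"
proof -
  have w: "w = (\<lambda>k. follower_reaction x0 u' k - follower_reaction x0 u k)"
    by (simp add: w_def reaction_stationary_pair)
  note line = follower_reaction_line[OF h_def[THEN meta_eq_to_obj_eq] w]
  have "leader_cost x0 ut (follower_reaction x0 ut)
      = leader_cost x0 (\<lambda>k. u k + t *\<^sub>R h k) (\<lambda>k. v k + t *\<^sub>R w k)"
    using line(2)[of t] by (intro cost_cong) (auto simp: ut_def h_def reaction_stationary_pair)
  also have "\<dots> = leader_cost x0 u v + t\<^sup>2 * leader_cost 0 h w"
    using lead line(1) unfolding leader_cost_expand leader_stationary_def by simp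
  finally show ?thesis .
qed

lemma leader_cost_diff:
  assumes "u' \<in> open_loop T"
  shows "leader_cost x0 u' (follower_reaction x0 u')
    = leader_cost x0 u v + leader_cost 0 (\<lambda>k. u' k - u k) (\<lambda>k. follower_reaction x0 u' k - v k)"
proof -
  have "(\<lambda>k\<in>{1..T}. u k + 1 *\<^sub>R (u' k - u k)) = u'"
    using assms by (intro open_loop_eqI[of _ T]) auto
  then show ?thesis using leader_cost_line[of 1 u'] by simp
qed

text \<open>The cost of any equilibrium bounds the reduced cost from below on each line through
  \<open>u\<close>, so the second variation cannot be negative; \<open>t = 1\<close> then gives
  optimality of \<open>u\<close>.\<close>

lemma equilibrium_stationary_pair:
  assumes "equilibrium x0 v1 v2"
  shows "equilibrium x0 u v"
  unfolding equilibrium_iff reaction_stationary_pair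
proof (intro conjI ballI u refl)
  fix u' :: "nat \<Rightarrow> real^'m1" assume u': "u' \<in> open_loop T"
  let ?b = "leader_cost 0 (\<lambda>k. u' k - u k) (\<lambda>k. follower_reaction x0 u' k - v k)"
  have "leader_cost x0 v1 (follower_reaction x0 v1) - leader_cost x0 u v \<le> t\<^sup>2 * ?b" for t
  proof -
    let ?ut = "\<lambda>k\<in>{1..T}. u k + t *\<^sub>R (u' k - u k)"
    have "leader_cost x0 v1 (follower_reaction x0 v1) \<le> leader_cost x0 ?ut (follower_reaction x0 ?ut)"
      using assms restrict_open_loop unfolding equilibrium_iff by blast
    then show ?thesis using leader_cost_line[of t u'] by linarith
  qed
  then have "0 \<le> ?b" by (rule quadratic_coeff_nonneg_if_bdd_below)
  then show "leader_cost x0 u v \<le> leader_cost x0 u' (follower_reaction x0 u')"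
    using leader_cost_diff[OF u'] by simp
qed

text \<open>The second variation now dominates half the squared norm of \<open>h\<close>: this gives
  optimality of \<open>u\<close>, and forces \<open>h = 0\<close> for any other optimum.\<close>

lemma equilibrium_unique_if_psd:
  assumes R12: "\<And>k. k \<in> {1..T} \<Longrightarrow> psd (R12 k)"
  shows "equilibrium x0 v1 v2 \<longleftrightarrow> v1 = u \<and> v2 = v"
proof -
  have ge: "(\<Sum>k=1..T. 1/2 * (h k \<bullet> h k)) \<le> leader_cost 0 h w" for h w
  proof -
    have "0 \<le> (\<Sum>k=1..T. 1/2 * (w k \<bullet> (R12 k *v w k)))"
      using R12 by (intro sum_nonneg) (simp add: psd_def)
    then show ?thesis
      using lq_cost_ge[of T Q1 h w R12 "traj 0 h w"] Q1_psd by (simp add: leader_cost_def)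
  qed
  have "0 \<le> leader_cost 0 h w" for h w
    using ge[of h w] by (rule order_trans[rotated]) (simp add: sum_nonneg)
  then have eq: "equilibrium x0 u v"
    using u leader_cost_diff by (simp add: equilibrium_iff reaction_stationary_pair)
  moreover have "v1 = u" if "equilibrium x0 v1 v2"
  proof (rule open_loop_eqI)
    show v1: "v1 \<in> open_loop T" using that by (simp add: equilibrium_iff)
    let ?h = "\<lambda>k. v1 k - u k" and ?w = "\<lambda>k. follower_reaction x0 v1 k - v k"
    have "leader_cost x0 v1 (follower_reaction x0 v1) \<le> leader_cost x0 u v"
      using that u by (auto simp: equilibrium_iff reaction_stationary_pair)
    then have "leader_cost 0 ?h ?w \<le> 0" using leader_cost_diff[OF v1] by simp
    with ge[of ?h ?w] have "\<forall>k\<in>{1..T}. ?h k = 0"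
      by (subst sum_half_inner_eq_0_iff[symmetric]) linarith
    then show "v1 k = u k" if "k \<in> {1..T}" for k using that by simp
  qed (rule u)
  ultimately show ?thesis using reaction_stationary_pair by (auto simp: equilibrium_iff)
qed

end

end

subsection \<open>Stationarity of the candidate\<close>

locale lq_game_coupled = lq_game T A B1 B2 Q1 Q2 R12 R21
  for T :: nat
    and A :: "nat \<Rightarrow> real^'p^'p"
    and B1 :: "nat \<Rightarrow> real^'m1^'p" and B2 :: "nat \<Rightarrow> real^'m2^'p"
    and Q1 Q2 :: "nat \<Rightarrow> real^'p^'p"
    and R12 :: "nat \<Rightarrow> real^'m2^'m2" and R21 :: "nat \<Rightarrow> real^'m1^'m1" +
  fixes \<Phi> D E P \<Lambda> M K1 K2 :: "nat \<Rightarrow> real^'p^'p" and N :: "nat \<Rightarrow> real^'p^'m2"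
    and x0 :: "real^'p"
  assumes coupled: "coupled_system T A B1 B2 Q1 Q2 R12 \<Phi> D E P \<Lambda> M N K1 K2"
    and D_invertible: "k < T \<Longrightarrow> invertible (D (Suc k))"
    and E_invertible: "k < T \<Longrightarrow> invertible (E k)"
begin

abbreviation us1 :: "nat \<Rightarrow> real^'m1" where "us1 \<equiv> candidate_strategy T B1 K1 \<Phi> x0"
abbreviation us2 :: "nat \<Rightarrow> real^'m2" where "us2 \<equiv> candidate_strategy T B2 K2 \<Phi> x0"
abbreviation xs :: "nat \<Rightarrow> real^'p" where "xs \<equiv> closed_trajectory \<Phi> x0"

text \<open>In the notation of the Lagrangian of the leader's problem: \<open>\<mu>\<close> and \<open>n\<close> are the multipliers of the
  follower's costate and optimality equations, \<open>lam\<close> that of the state equation. The latter is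
  \<open>(\<Lambda> + Q2 M) x\<close> rather than \<open>\<Lambda> x\<close>: the recursion for \<open>\<Lambda>\<close> keeps the term \<open>Q2 \<mu>\<close> apart.\<close>

definition "\<mu> k = M k *v xs k"
definition "n k = N k *v xs (k - 1)"
definition "lam k = \<Lambda> k *v xs k + Q2 k *v \<mu> k"
definition "p k = P k *v xs k"

lemmas mv_simps = matrix_vector_mult_add_rdistrib matrix_vector_mult_diff_rdistrib
  matrix_vector_mult_diff_distrib matrix_vector_right_distrib matrix_vector_mul_assoc[symmetric]

declare transpose_matrix_vector [simp del]

section \<open>The coupled system in closed-loop form\<close>

lemma coupled_step:
  assumes "k < T"
  defines "X \<equiv> transpose (B2 (Suc k)) ** Q2 (Suc k) ** B2 (Suc k) + mat 1"
  shows \<Phi>_eq: "\<Phi> k = matrix_inv (D (Suc k)) ** E k"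
    and E_eq: "E k = A (Suc k) - B1 (Suc k) ** transpose (B1 (Suc k)) ** Q2 (Suc k) **
        matrix_inv (mat 1 + B2 (Suc k) ** transpose (B2 (Suc k)) ** Q2 (Suc k)) ** A (Suc k) ** M k"
    and D_eq: "D (Suc k) = mat 1 + B1 (Suc k) ** transpose (B1 (Suc k)) **
          matrix_inv (mat 1 + Q2 (Suc k) ** (B2 (Suc k) ** transpose (B2 (Suc k)))) ** \<Lambda> (Suc k)
        + B1 (Suc k) ** transpose (B1 (Suc k)) ** Q2 (Suc k) ** B2 (Suc k) ** matrix_inv X **
          R12 (Suc k) ** transpose (B2 (Suc k)) ** P (Suc k)
        + B2 (Suc k) ** transpose (B2 (Suc k)) ** P (Suc k)"
    and P_eq: "P k = Q2 k + transpose (A (Suc k)) ** P (Suc k) ** \<Phi> k"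
    and \<Lambda>_eq: "\<Lambda> k = Q1 k + transpose (A (Suc k)) ** (\<Lambda> (Suc k) ** \<Phi> k
        + Q2 (Suc k) ** A (Suc k) ** M k - Q2 (Suc k) ** B2 (Suc k) ** N (Suc k))"
    and M_eq: "M (Suc k) = (A (Suc k) ** M k - B2 (Suc k) ** N (Suc k)) ** matrix_inv (\<Phi> k)"
    and N_eq: "N (Suc k) = matrix_inv X ** (transpose (B2 (Suc k)) ** \<Lambda> (Suc k) ** \<Phi> k
        - R12 (Suc k) ** transpose (B2 (Suc k)) ** K2 (Suc k)
        + transpose (B2 (Suc k)) ** Q2 (Suc k) ** A (Suc k) ** M k)"
    and K1_eq: "K1 (Suc k) = matrix_inv (mat 1 + Q2 (Suc k) ** (B2 (Suc k) ** transpose (B2 (Suc k)))) **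
          \<Lambda> (Suc k) ** \<Phi> k
        + Q2 (Suc k) ** B2 (Suc k) ** matrix_inv X ** R12 (Suc k) ** transpose (B2 (Suc k)) **
          P (Suc k) ** \<Phi> k
        + Q2 (Suc k) ** matrix_inv (mat 1 + B2 (Suc k) ** transpose (B2 (Suc k)) ** Q2 (Suc k)) **
          A (Suc k) ** M k"
    and K2_eq: "K2 (Suc k) = P (Suc k) ** \<Phi> k"
  using coupled[unfolded coupled_system_def Let_def, THEN conjunct2, THEN conjunct2,
      THEN conjunct2, rule_format, OF assms(1), folded Suc_eq_plus1]
  unfolding X_def by - (elim conjE, assumption)+

text \<open>As a product of invertible matrices \<open>\<Phi> k\<close> is invertible, so the
  inverse in the recursion for \<open>M\<close> cancels.\<close>

lemma M_closed_loop:
  assumes "k < T"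
  shows "M (Suc k) *v (\<Phi> k *v z) = A (Suc k) *v (M k *v z) - B2 (Suc k) *v (N (Suc k) *v z)"
proof -
  have "invertible (matrix_inv (D (Suc k)))"
    using D_invertible[OF assms] matrix_inv_left matrix_inv_right unfolding invertible_def by blast
  then have "invertible (\<Phi> k)"
    unfolding \<Phi>_eq[OF assms] using E_invertible[OF assms] by (rule invertible_mult)
  then show ?thesis unfolding M_eq[OF assms] by (simp add: mv_simps matrix_inv_vector)
qed

text \<open>Multiplying by \<open>X\<close> and moving the \<open>Q2\<close> part of
  \<open>X\<close> to the right makes the equation implicit: the \<open>Q2\<close> terms combine to
  \<open>A M - B2 N\<close>, which is \<open>M \<Phi>\<close>.\<close>

lemma N_closed_loop:
  assumes "k < T"
  shows "N (Suc k) *v z = transpose (B2 (Suc k)) *v (\<Lambda> (Suc k) *v (\<Phi> k *v z)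
        + Q2 (Suc k) *v (M (Suc k) *v (\<Phi> k *v z)))
      - R12 (Suc k) *v (transpose (B2 (Suc k)) *v (K2 (Suc k) *v z))"
proof -
  let ?X = "transpose (B2 (Suc k)) ** Q2 (Suc k) ** B2 (Suc k) + mat 1"
  have "invertible ?X" using assms by (intro invertible_gram_plus_id Q2_psd) simp
  then have "?X *v (N (Suc k) *v z) = (transpose (B2 (Suc k)) ** \<Lambda> (Suc k) ** \<Phi> k
      - R12 (Suc k) ** transpose (B2 (Suc k)) ** K2 (Suc k)
      + transpose (B2 (Suc k)) ** Q2 (Suc k) ** A (Suc k) ** M k) *v z"
    by (subst N_eq[OF assms]) (simp only: matrix_vector_mul_assoc[symmetric] matrix_inv_vector)
  then show ?thesis by (simp add: mv_simps M_closed_loop[OF assms] algebra_simps)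
qed

text \<open>After the Woodbury rewriting, all terms containing the inverse of \<open>X\<close> add
  up to \<open>- Q2 B2 N\<close>; again \<open>A M - B2 N\<close> is
  \<open>M \<Phi>\<close>.\<close>

lemma K1_closed_loop:
  assumes "k < T"
  shows "K1 (Suc k) *v z = \<Lambda> (Suc k) *v (\<Phi> k *v z) + Q2 (Suc k) *v (M (Suc k) *v (\<Phi> k *v z))"
proof -
  have "psd (Q2 (Suc k))" using assms by (intro Q2_psd) simp
  note w = woodbury_vector[OF this, of "B2 (Suc k)"]
  show ?thesis
    by (simp add: K1_eq[OF assms] M_closed_loop[OF assms] N_eq[OF assms] K2_eq[OF assms] mv_simps w)
qed

text \<open>In \<open>D \<Phi> = E\<close>, the part of \<open>K1\<close> with factor
  \<open>\<Phi>\<close> comes from \<open>D\<close> and the part with factor \<open>M\<close> from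
  \<open>E\<close>.\<close>

lemma \<Phi>_closed_loop:
  assumes "k < T"
  shows "\<Phi> k *v z = A (Suc k) *v z - B1 (Suc k) *v (transpose (B1 (Suc k)) *v (K1 (Suc k) *v z))
    - B2 (Suc k) *v (transpose (B2 (Suc k)) *v (K2 (Suc k) *v z))"
proof -
  have "D (Suc k) *v (\<Phi> k *v z) = E k *v z"
    unfolding \<Phi>_eq[OF assms] using D_invertible[OF assms] by (simp add: mv_simps matrix_inv_vector)
  then show ?thesis
    by (simp add: D_eq[OF assms] E_eq[OF assms] K1_eq[OF assms] K2_eq[OF assms] mv_simps algebra_simps)
qed

section \<open>Optimality conditions along the candidate trajectory\<close>

lemma us_eq:
  assumes "k < T"
  shows "us1 (Suc k) = - (transpose (B1 (Suc k)) *v (K1 (Suc k) *v xs k))"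
    and "us2 (Suc k) = - (transpose (B2 (Suc k)) *v (K2 (Suc k) *v xs k))"
  using assms by (simp_all add: candidate_strategy_def mv_simps)

lemma traj_candidate: "k \<le> T \<Longrightarrow> traj x0 us1 us2 k = xs k"
proof (induction k)
  case (Suc k)
  then show ?case using \<Phi>_closed_loop[of k "xs k"] by (simp add: us_eq linear_neg)
qed simp

text \<open>In order: stationarity of the Lagrangian in the leader's control, the follower's
  optimality condition, and stationarity in the follower's control and costate.\<close>

lemma us_costate:
  assumes "k \<in> {1..T}"
  shows "us1 k = - (transpose (B1 k) *v lam k)"
    and "us2 k = - (transpose (B2 k) *v p k)"
    and "n k = transpose (B2 k) *v lam k + R12 k *v us2 k"
    and "\<mu> k = A k *v \<mu> (k - 1) - B2 k *v n k"
proof -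
  obtain j where j: "k = Suc j" "j < T" using assms by (cases k) auto
  show "us1 k = - (transpose (B1 k) *v lam k)" "us2 k = - (transpose (B2 k) *v p k)"
    "n k = transpose (B2 k) *v lam k + R12 k *v us2 k" "\<mu> k = A k *v \<mu> (k - 1) - B2 k *v n k"
    using j N_closed_loop[OF j(2), of "xs j"] M_closed_loop[OF j(2), of "xs j"]
    by (simp_all add: us_eq K1_closed_loop K2_eq lam_def \<mu>_def p_def n_def linear_neg mv_simps)
qed

text \<open>In the recursion for \<open>\<Lambda>\<close> the terms with \<open>M\<close> and
  \<open>N\<close> combine to \<open>Q2 M \<Phi>\<close>, which completes \<open>\<Lambda>\<close>
  to \<open>lam\<close> at the next stage.\<close>

lemma costate_step:
  assumes "k < T"
  shows "p k = Q2 k *v xs k + transpose (A (Suc k)) *v p (Suc k)"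
    and "lam k = (Q1 k *v xs k + Q2 k *v \<mu> k) + transpose (A (Suc k)) *v lam (Suc k)"
  using assms
  by (simp_all add: p_def lam_def \<mu>_def P_eq \<Lambda>_eq M_closed_loop mv_simps algebra_simps)

lemma costate_end:
  "p T = Q2 T *v xs T" "lam T = Q1 T *v xs T + Q2 T *v \<mu> T"
  using coupled by (simp_all add: coupled_system_def p_def lam_def)

text \<open>\<open>p\<close> is the costate for the source \<open>Q2 k *v xs k\<close>, and
  \<open>us2 k\<close> is minus its image under the transposed \<open>B2 k\<close>, so both parts of
  the first variation cancel.\<close>

lemma candidate_follower_stationary: "follower_stationary x0 us1 us2"
  unfolding follower_stationary_def
proof
  fix z
  let ?y = "traj 0 (\<lambda>_. 0) z"
  have "(\<Sum>k=1..T. (Q2 k *v xs k) \<bullet> ?y k) = (\<Sum>k=1..T. p k \<bullet> (B2 k *v z k))"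
    by (rule sum_adjoint[where A = A]) (auto simp: costate_step costate_end)
  then have "(\<Sum>k=1..T. (Q2 k *v xs k) \<bullet> ?y k - p k \<bullet> (B2 k *v z k)) = 0"
    by (simp add: sum_subtractf)
  also have "(\<Sum>k=1..T. (Q2 k *v xs k) \<bullet> ?y k - p k \<bullet> (B2 k *v z k))
      = (\<Sum>k=1..T. traj x0 us1 us2 k \<bullet> (Q2 k *v ?y k) + us2 k \<bullet> z k)"
  proof (rule sum.cong[OF refl])
    fix k assume k: "k \<in> {1..T}"
    have "traj x0 us1 us2 k \<bullet> (Q2 k *v ?y k) = (Q2 k *v xs k) \<bullet> ?y k"
      using k Q2_psd[OF k]
      by (simp add: traj_candidate psd_def symmetric_inner_commute[of "Q2 k" "xs k"] inner_commute)
    moreover have "us2 k \<bullet> z k = - (p k \<bullet> (B2 k *v z k))"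
      using us_costate(2)[OF k] by (simp add: transpose_matrix_vector dot_lmul_matrix)
    ultimately show "(Q2 k *v xs k) \<bullet> ?y k - p k \<bullet> (B2 k *v z k)
        = traj x0 us1 us2 k \<bullet> (Q2 k *v ?y k) + us2 k \<bullet> z k" by simp
  qed
  finally show "(\<Sum>k=1..T. traj x0 us1 us2 k \<bullet> (Q2 k *v ?y k) + us2 k \<bullet> z k) = 0" .
qed

text \<open>The multiplier \<open>\<mu>\<close> is the state response to the follower deviation \<open>-n\<close>, so the stationarity
  of the follower's variation can be tested against it.\<close>

lemma candidate_leader_stationary: "leader_stationary x0 us1 us2"
  unfolding leader_stationary_def
proof (intro allI impI)
  fix h w assume hw: "follower_stationary 0 h w"
  let ?y = "traj 0 h w"
  have \<mu>: "traj 0 (\<lambda>_. 0) (\<lambda>k. - n k) k = \<mu> k" if "k \<le> T" for k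
    using that
  proof (induction k)
    case 0
    then show ?case using coupled by (simp add: \<mu>_def coupled_system_def)
  next
    case (Suc k)
    then show ?case using us_costate(4)[of "Suc k"] by (simp add: linear_neg)
  qed
  have adj: "(\<Sum>k=1..T. (Q1 k *v xs k + Q2 k *v \<mu> k) \<bullet> ?y k)
      = (\<Sum>k=1..T. lam k \<bullet> (B1 k *v h k + B2 k *v w k))"
    by (rule sum_adjoint[where A = A]) (auto simp: costate_step costate_end)
  have "(\<Sum>k=1..T. ?y k \<bullet> (Q2 k *v \<mu> k) + w k \<bullet> - n k)
      = (\<Sum>k=1..T. ?y k \<bullet> (Q2 k *v traj 0 (\<lambda>_. 0) (\<lambda>k. - n k) k) + w k \<bullet> - n k)"
    by (intro sum.cong) (auto simp: \<mu>)
  also have "\<dots> = 0" using hw unfolding follower_stationary_def by blast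
  finally have test: "(\<Sum>k=1..T. ?y k \<bullet> (Q2 k *v \<mu> k) + w k \<bullet> - n k) = 0" .
  \<comment> \<open>The leader's first variation is the adjoint identity minus the tested follower
    condition: the added \<open>Q2 \<mu>\<close> terms cancel, and the relation for \<open>n\<close>
    accounts for \<open>R12\<close> and \<open>B2\<close>.\<close>
  have "(\<Sum>k=1..T. xs k \<bullet> (Q1 k *v ?y k) + us1 k \<bullet> h k + us2 k \<bullet> (R12 k *v w k))
      = (\<Sum>k=1..T. (Q1 k *v xs k + Q2 k *v \<mu> k) \<bullet> ?y k)
        - (\<Sum>k=1..T. lam k \<bullet> (B1 k *v h k + B2 k *v w k))
        - (\<Sum>k=1..T. ?y k \<bullet> (Q2 k *v \<mu> k) + w k \<bullet> - n k)"
    unfolding sum_subtractf[symmetric]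
  proof (rule sum.cong[OF refl])
    fix k assume k: "k \<in> {1..T}"
    have "us2 k \<bullet> (R12 k *v w k) = w k \<bullet> (n k - transpose (B2 k) *v lam k)"
      using us_costate(3)[OF k] R12_sym[OF k] by (simp add: symmetric_inner_commute)
    moreover have "xs k \<bullet> (Q1 k *v ?y k) = ?y k \<bullet> (Q1 k *v xs k)"
      using Q1_psd[OF k] by (simp add: psd_def symmetric_inner_commute)
    moreover have "us1 k \<bullet> h k = - (lam k \<bullet> (B1 k *v h k))"
      using us_costate(1)[OF k] by (simp add: transpose_matrix_vector dot_lmul_matrix)
    moreover have "w k \<bullet> (transpose (B2 k) *v lam k) = lam k \<bullet> (B2 k *v w k)"
      by (metis transpose_matrix_vector dot_lmul_matrix inner_commute)
    ultimately show "xs k \<bullet> (Q1 k *v ?y k) + us1 k \<bullet> h k + us2 k \<bullet> (R12 k *v w k)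
        = (Q1 k *v xs k + Q2 k *v \<mu> k) \<bullet> ?y k - lam k \<bullet> (B1 k *v h k + B2 k *v w k)
          - (?y k \<bullet> (Q2 k *v \<mu> k) + w k \<bullet> - n k)"
      by (simp add: inner_add_left inner_add_right inner_diff_right inner_commute[of _ "?y k"])
  qed
  then have "(\<Sum>k=1..T. xs k \<bullet> (Q1 k *v ?y k) + us1 k \<bullet> h k + us2 k \<bullet> (R12 k *v w k)) = 0"
    using adj test by simp
  then show "(\<Sum>k=1..T. traj x0 us1 us2 k \<bullet> (Q1 k *v ?y k) + us1 k \<bullet> h k + us2 k \<bullet> (R12 k *v w k)) = 0"
    by (simp add: traj_candidate)
qed

lemma candidate_open_loop: "us1 \<in> open_loop T" "us2 \<in> open_loop T"
  by (simp_all add: candidate_strategy_def)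

lemmas candidate = candidate_open_loop candidate_follower_stationary candidate_leader_stationary

end

text \<open>For indefinite \<open>R12\<close> the leader's second variation can be negative, so
  there the claims presuppose an equilibrium; positive semidefinite \<open>R12\<close> yields
  existence and uniqueness outright.\<close>

theorem proposition6:
  fixes T :: nat
    and A :: "nat \<Rightarrow> real^'p^'p"
    and B1 :: "nat \<Rightarrow> real^'m1^'p" and B2 :: "nat \<Rightarrow> real^'m2^'p"
    and Q1 Q2 :: "nat \<Rightarrow> real^'p^'p"
    and R12 :: "nat \<Rightarrow> real^'m2^'m2" and R21 :: "nat \<Rightarrow> real^'m1^'m1"
    and \<Phi> D E P \<Lambda> M K1 K2 :: "nat \<Rightarrow> real^'p^'p" and N :: "nat \<Rightarrow> real^'p^'m2"
    and x0 :: "real^'p"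
  defines "equilibrium \<equiv> open_loop_stackelberg T A B1 B2 Q1 Q2 R12 R21 x0"
    and "us1 \<equiv> candidate_strategy T B1 K1 \<Phi> x0"
    and "us2 \<equiv> candidate_strategy T B2 K2 \<Phi> x0"
  assumes "1 \<le> T"
    and "Q1 0 = 0" and "Q2 0 = 0"
    and "\<forall>k\<in>{1..T}. transpose (R12 k) = R12 k \<and> transpose (R21 k) = R21 k"
    and "\<forall>k\<in>{1..T}. psd (Q1 k) \<and> psd (Q2 k)"
    and "coupled_system T A B1 B2 Q1 Q2 R12 \<Phi> D E P \<Lambda> M N K1 K2"
    and "\<forall>k<T. invertible (D (k + 1)) \<and> invertible (E k)"
  shows "(\<forall>k\<le>T. state A B1 B2 x0 us1 us2 k = closed_trajectory \<Phi> x0 k)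
    \<and> ((\<exists>v1 v2. equilibrium v1 v2) \<longrightarrow> equilibrium us1 us2)
    \<and> ((\<exists>!v. equilibrium (fst v) (snd v)) \<longrightarrow>
         (\<forall>v1 v2. equilibrium v1 v2 \<longleftrightarrow> v1 = us1 \<and> v2 = us2))
    \<and> ((\<forall>k\<in>{1..T}. psd (R12 k)) \<longrightarrow>
         (\<forall>v1 v2. equilibrium v1 v2 \<longleftrightarrow> v1 = us1 \<and> v2 = us2))"
proof -
  interpret game: lq_game_coupled T A B1 B2 Q1 Q2 R12 R21 \<Phi> D E P \<Lambda> M K1 K2 N x0
    using assms(7-10) by unfold_locales auto
  have exists: "equilibrium us1 us2" if "equilibrium v1 v2" for v1 v2
    using that unfolding assms(1-3) by (rule game.equilibrium_stationary_pair[OF game.candidate])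
  show ?thesis
  proof (intro conjI impI)
    show "\<forall>k\<le>T. state A B1 B2 x0 us1 us2 k = closed_trajectory \<Phi> x0 k"
      unfolding assms(2,3) by (simp add: game.traj_candidate)
    show "equilibrium us1 us2" if "\<exists>v1 v2. equilibrium v1 v2"
      using that exists by blast
    show "\<forall>v1 v2. equilibrium v1 v2 \<longleftrightarrow> v1 = us1 \<and> v2 = us2" if "\<exists>!v. equilibrium (fst v) (snd v)"
      using that exists by (metis fst_conv snd_conv)
    show "\<forall>v1 v2. equilibrium v1 v2 \<longleftrightarrow> v1 = us1 \<and> v2 = us2" if "\<forall>k\<in>{1..T}. psd (R12 k)"
      using game.equilibrium_unique_if_psd[OF game.candidate] that unfolding assms(1-3) by blast
  qed
qed

end
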